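(* For every $t\in\mathbb{N}$ and every $\beta=(\beta_3,\beta_4,\dots,\beta_t)\in\mathbb{C}^{t-2}$, the Lie algebra $R(\mathfrak{m}_0,2,\beta)$ is complete.
   Context: $R(\mathfrak{m}_0,2,\beta)$ is the Lie algebra over $\mathbb{C}$ with basis $\{x,y,e_1,e_2,\dots\}$ (elements are finite linear combinations of basis elements) and products $$[e_i,e_1]=e_{i+1}\ (i\ge 2),\quad [e_1,x]=e_1,\quad [e_i,x]=(i-1)e_i+\sum_{q=3}^{t}\beta_q e_{q+i-2}\ (i\ge 2),\quad [e_i,y]=e_i\ (i\ge 2),$$ where products of basis elements that are neither listed nor obtained from listed ones by antisymmetry are zero, and empty sums are zero. A derivation is a linear map $d$ with $d([a,b])=[d(a),b]+[a,d(b)]$; it is inner if it equals $b\mapsto[a,b]$ for some element $a$. An algebra is complete if its center is zero and all its derivations are inner. *)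

theory Defs
  imports Complex_Main "HOL-Library.Poly_Mapping"
begin

locale lie_algebra = vector_space scale
  for scale :: "'k::field \<Rightarrow> 'a::ab_group_add \<Rightarrow> 'a" (infixr \<open>*s\<close> 75) +
  fixes bracket :: "'a \<Rightarrow> 'a \<Rightarrow> 'a"
  assumes bracket_add_left: "bracket (a + b) c = bracket a c + bracket b c"
    and bracket_add_right: "bracket a (b + c) = bracket a b + bracket a c"
    and bracket_scale_left: "bracket (r *s a) b = r *s bracket a b"
    and bracket_scale_right: "bracket a (r *s b) = r *s bracket a b"
    and bracket_self: "bracket a a = 0"
    and jacobi: "bracket (bracket a b) c + bracket (bracket b c) a + bracket (bracket c a) b = 0"
begin

definition center :: "'a set"
  where "center = {a. \<forall>b. bracket a b = 0}"

definition derivation :: "('a \<Rightarrow> 'a) \<Rightarrow> bool"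
  where "derivation d \<longleftrightarrow> Vector_Spaces.linear scale scale d \<and>
    (\<forall>a b. d (bracket a b) = bracket (d a) b + bracket a (d b))"

definition inner :: "('a \<Rightarrow> 'a) \<Rightarrow> bool"
  where "inner d \<longleftrightarrow> (\<exists>a. \<forall>b. d b = bracket a b)"

definition complete :: bool
  where "complete \<longleftrightarrow> center = {0} \<and> (\<forall>d. derivation d \<longrightarrow> inner d)"

end

datatype gen = X | Y | E nat

type_synonym R_space = "gen \<Rightarrow>\<^sub>0 complex"

definition cscale :: "complex \<Rightarrow> R_space \<Rightarrow> R_space"
  where "cscale c = Poly_Mapping.map ((*) c)"

text \<open>The constructor \<^term>\<open>E n\<close> labels the basis vector $e_{n+1}$, so that the labels are
  exactly $x, y, e_1, e_2, \dots$ with none left over. The vectors \<open>vec_e i\<close> are numbered from 1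
  as usual; \<open>vec_e 0\<close> is a junk value, never used.\<close>

definition vec_x :: R_space where "vec_x = Poly_Mapping.single X 1"
definition vec_y :: R_space where "vec_y = Poly_Mapping.single Y 1"
definition vec_e :: "nat \<Rightarrow> R_space" where "vec_e i = Poly_Mapping.single (E (i - 1)) 1"

text \<open>The table of listed products of basis elements; all other entries are zero. The table
  never lists both $[u,v]$ and $[v,u]$, so \<open>basis_bracket\<close> is its antisymmetric
  completion. Of \<open>\<beta>\<close>, only the values $\beta_3, \dots, \beta_t$ are used.\<close>

fun listed :: "nat \<Rightarrow> (nat \<Rightarrow> complex) \<Rightarrow> gen \<Rightarrow> gen \<Rightarrow> R_space"
  where
    "listed t \<beta> (E m) (E n) =
       (let i = m + 1; j = n + 1 in if i \<ge> 2 \<and> j = 1 then vec_e (i + 1) else 0)"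
  | "listed t \<beta> (E m) X =
       (let i = m + 1 in if i = 1 then vec_e 1
        else cscale (of_nat (i - 1)) (vec_e i) + (\<Sum>q = 3..t. cscale (\<beta> q) (vec_e (q + i - 2))))"
  | "listed t \<beta> (E m) Y = (let i = m + 1 in if i \<ge> 2 then vec_e i else 0)"
  | "listed t \<beta> X v = 0"
  | "listed t \<beta> Y v = 0"

definition basis_bracket :: "nat \<Rightarrow> (nat \<Rightarrow> complex) \<Rightarrow> gen \<Rightarrow> gen \<Rightarrow> R_space"
  where "basis_bracket t \<beta> u v = listed t \<beta> u v - listed t \<beta> v u"

definition R_bracket :: "nat \<Rightarrow> (nat \<Rightarrow> complex) \<Rightarrow> R_space \<Rightarrow> R_space \<Rightarrow> R_space"
  where "R_bracket t \<beta> a b =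
    (\<Sum>u\<in>Poly_Mapping.keys a. \<Sum>v\<in>Poly_Mapping.keys b.
       cscale (Poly_Mapping.lookup a u * Poly_Mapping.lookup b v) (basis_bracket t \<beta> u v))"

lemma lookup_cscale: "Poly_Mapping.lookup (cscale c a) k = c * Poly_Mapping.lookup a k"
  by (simp add: cscale_def Poly_Mapping.map.rep_eq when_def)

lemma vector_space_cscale: "vector_space cscale"
  by standard (auto intro!: poly_mapping_eqI simp: lookup_cscale lookup_add algebra_simps)

interpretation cscale: vector_space cscale
  by (rule vector_space_cscale)

lemma R_bracket_add_left: "R_bracket t \<beta> (a + b) c = R_bracket t \<beta> a c + R_bracket t \<beta> b c"
  unfolding R_bracket_def
  by (rule setsum_keys_plus_distrib)
    (simp_all add: algebra_simps cscale.scale_left_distrib sum.distrib)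

lemma R_bracket_anti: "R_bracket t \<beta> a b = - R_bracket t \<beta> b a"
proof -
  have "basis_bracket t \<beta> u v = - basis_bracket t \<beta> v u" for u v
    by (simp add: basis_bracket_def)
  hence "R_bracket t \<beta> a b = (\<Sum>u\<in>Poly_Mapping.keys a. \<Sum>v\<in>Poly_Mapping.keys b.
       - cscale (Poly_Mapping.lookup b v * Poly_Mapping.lookup a u) (basis_bracket t \<beta> v u))"
    unfolding R_bracket_def
    by (intro sum.cong refl) (metis cscale.scale_minus_right mult.commute)
  also have "\<dots> = - R_bracket t \<beta> b a"
    unfolding R_bracket_def by (subst sum.swap) (simp add: sum_negf)
  finally show ?thesis .
qed

lemma R_bracket_add_right: "R_bracket t \<beta> a (b + c) = R_bracket t \<beta> a b + R_bracket t \<beta> a c"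
  by (simp add: R_bracket_anti[of _ _ a] R_bracket_add_left)

lemma R_bracket_scale_left: "R_bracket t \<beta> (cscale r a) b = cscale r (R_bracket t \<beta> a b)"
proof (cases "r = 0")
  case False
  hence "Poly_Mapping.keys (cscale r a) = Poly_Mapping.keys a"
    by (auto simp: in_keys_iff lookup_cscale)
  thus ?thesis
    by (simp add: R_bracket_def lookup_cscale cscale.scale_sum_right mult.assoc)
qed (simp add: R_bracket_def)

lemma R_bracket_scale_right: "R_bracket t \<beta> a (cscale r b) = cscale r (R_bracket t \<beta> a b)"
  by (simp add: R_bracket_anti[of _ _ a] R_bracket_scale_left)

lemma R_bracket_self: "R_bracket t \<beta> a a = 0"
proof -
  have "R_bracket t \<beta> a a + R_bracket t \<beta> a a = 0"
    by (subst R_bracket_anti) simp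
  hence "cscale 2 (R_bracket t \<beta> a a) = 0"
    using cscale.scale_left_distrib[of 1 1] by simp
  thus ?thesis by simp
qed

lemma R_bracket_zero: "R_bracket t \<beta> 0 a = 0" "R_bracket t \<beta> a 0 = 0"
  by (simp_all add: R_bracket_def)

lemma R_bracket_minus: "R_bracket t \<beta> (- a) b = - R_bracket t \<beta> a b"
    "R_bracket t \<beta> a (- b) = - R_bracket t \<beta> a b"
  using R_bracket_scale_left[of t \<beta> "-1" a b] R_bracket_scale_right[of t \<beta> a "-1" b] by simp_all

lemma R_bracket_diff_left: "R_bracket t \<beta> (a - b) c = R_bracket t \<beta> a c - R_bracket t \<beta> b c"
  using R_bracket_add_left[of t \<beta> a "- b" c] by (simp add: R_bracket_minus)

lemma R_bracket_sum_left: "R_bracket t \<beta> (sum f A) b = (\<Sum>i\<in>A. R_bracket t \<beta> (f i) b)"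
  by (induction A rule: infinite_finite_induct) (simp_all add: R_bracket_zero R_bracket_add_left)

lemma R_bracket_basis:
  "R_bracket t \<beta> (Poly_Mapping.single u 1) (Poly_Mapping.single v 1) = basis_bracket t \<beta> u v"
  by (simp add: R_bracket_def)

lemma R_bracket_listed:
  "i \<ge> 2 \<Longrightarrow> R_bracket t \<beta> (vec_e i) (vec_e 1) = vec_e (i + 1)"
  "R_bracket t \<beta> (vec_e 1) vec_x = vec_e 1"
  "i \<ge> 2 \<Longrightarrow> R_bracket t \<beta> (vec_e i) vec_x =
     cscale (of_nat (i - 1)) (vec_e i) + (\<Sum>q = 3..t. cscale (\<beta> q) (vec_e (q + i - 2)))"
  "i \<ge> 2 \<Longrightarrow> R_bracket t \<beta> (vec_e i) vec_y = vec_e i"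
  by (simp_all add: vec_e_def vec_x_def vec_y_def R_bracket_basis basis_bracket_def)

lemma R_bracket_unlisted:
  "i \<ge> 2 \<Longrightarrow> j \<ge> 2 \<Longrightarrow> R_bracket t \<beta> (vec_e i) (vec_e j) = 0"
  "R_bracket t \<beta> (vec_e 1) vec_y = 0"
  "R_bracket t \<beta> vec_x vec_y = 0"
  by (simp_all add: vec_e_def vec_x_def vec_y_def R_bracket_basis basis_bracket_def)

lemma gen_cases:
  obtains "Poly_Mapping.single u 1 = vec_x" | "Poly_Mapping.single u 1 = vec_y"
    | "Poly_Mapping.single u 1 = vec_e 1"
    | i where "i \<ge> 2" "Poly_Mapping.single u 1 = vec_e i"
proof (cases u)
  case (E n)
  show ?thesis
  proof (cases n)
    case 0
    thus ?thesis using that(3) E by (simp add: vec_e_def)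
  next
    case (Suc m)
    thus ?thesis using that(4)[of "n + 1"] E by (simp add: vec_e_def)
  qed
qed (use that(1,2) in \<open>simp_all add: vec_x_def vec_y_def\<close>)

lemma R_induct:
  assumes "P 0" "\<And>a b. P a \<Longrightarrow> P b \<Longrightarrow> P (a + b)" "\<And>c a. P a \<Longrightarrow> P (cscale c a)"
    and "P vec_x" "P vec_y" "P (vec_e 1)" "\<And>i. i \<ge> 2 \<Longrightarrow> P (vec_e i)"
  shows "P a"
proof (induction a rule: Poly_Mapping.update_induct)
  case (update f k c)
  have "Poly_Mapping.update k c f = f + cscale c (Poly_Mapping.single k 1)"
    using update(1) by (intro poly_mapping_eqI)
      (auto simp: lookup_add lookup_cscale lookup_update lookup_single when_def in_keys_iff)
  moreover have "P (Poly_Mapping.single k 1)"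
    by (rule gen_cases[of k]) (use assms(4-7) in simp_all)
  ultimately show ?case
    using assms(2,3) update by simp
qed (rule assms(1))

lemma R_jacobi:
  "R_bracket t \<beta> (R_bracket t \<beta> a b) c + R_bracket t \<beta> (R_bracket t \<beta> b c) a
     + R_bracket t \<beta> (R_bracket t \<beta> c a) b = 0"
  (is "?J a b c = 0")
proof -
  note lin = R_bracket_add_left R_bracket_add_right R_bracket_scale_left R_bracket_scale_right
    R_bracket_zero R_bracket_minus R_bracket_diff_left
    R_bracket_sum_left R_bracket_self
  have add: "?J (a + a') b c = ?J a b c + ?J a' b c" for a a' b c
    by (simp add: lin algebra_simps)
  have scl: "?J (cscale r a) b c = cscale r (?J a b c)" for r a b c
    by (simp add: lin cscale.scale_right_distrib)
  have zro: "?J 0 b c = 0" for b c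
    by (simp add: lin)
  have rot: "?J a b c = ?J b c a" for a b c
    by (simp add: algebra_simps)
  have swap: "?J a b c = 0" if "?J b a c = 0" for a b c
  proof -
    have "?J a b c = - ?J b a c"
      unfolding R_bracket_anti[of t \<beta> a b] R_bracket_anti[of t \<beta> b c] R_bracket_anti[of t \<beta> c a]
      by (simp only: lin) simp
    thus ?thesis using that by (simp only: minus_zero)
  qed
  have rotate: "?J a b c = 0" if "?J b c a = 0" for a b c
    using that rot[of a b c] by (simp only:)
  have dup: "?J a a c = 0" for a c
    unfolding R_bracket_anti[of t \<beta> c a] by (simp only: lin) simp
  have perm: "?J a c b = 0" "?J b a c = 0" "?J b c a = 0" "?J c a b = 0" "?J c b a = 0"
    if *: "?J a b c = 0" for a b c
  proof -
    show A: "?J b c a = 0" by (rule rotate, rule rotate, rule *)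
    show B: "?J c a b = 0" by (rule rotate, rule *)
    show "?J a c b = 0" by (rule swap, rule B)
    show "?J b a c = 0" by (rule swap, rule *)
    show "?J c b a = 0" by (rule swap, rule A)
  qed
  have dups: "?J a c a = 0" "?J c a a = 0" for a c
    by (rule rotate, rule rotate, rule dup) (rule rotate, rule dup)
  have shift: "q + (i + 1) - 2 = q + i - 2 + 1" if "i \<ge> 2" for q i :: nat
    using that by simp
  have idx: "2 \<le> q + i - 2" if "2 \<le> i" "3 \<le> q" for q i :: nat
    using that by linarith
  have rev: "R_bracket t \<beta> (vec_e 1) (vec_e i) = - vec_e (i + 1)"
    "R_bracket t \<beta> vec_x (vec_e i) =
       - (cscale (of_nat (i - 1)) (vec_e i) + (\<Sum>q = 3..t. cscale (\<beta> q) (vec_e (q + i - 2))))"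
    "R_bracket t \<beta> vec_y (vec_e i) = - vec_e i" if "i \<ge> 2" for i
    using that by (subst R_bracket_anti, simp add: R_bracket_listed del: One_nat_def)+
  have rev': "R_bracket t \<beta> vec_x (vec_e 1) = - vec_e 1" "R_bracket t \<beta> vec_y (vec_e 1) = 0"
    "R_bracket t \<beta> vec_y vec_x = 0"
    by (subst R_bracket_anti, simp add: R_bracket_listed R_bracket_unlisted del: One_nat_def)+
  note eqs = lin R_bracket_listed R_bracket_unlisted rev rev'
  have eee: "?J (vec_e i) (vec_e j) (vec_e k) = 0" if "i \<ge> 2" "j \<ge> 2" "k \<ge> 2" for i j k
    using that by (simp add: eqs)
  have ee1: "?J (vec_e i) (vec_e j) (vec_e 1) = 0" if "i \<ge> 2" "j \<ge> 2" for i j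
    using that by (simp add: eqs del: One_nat_def)
  have eex: "?J (vec_e i) (vec_e j) vec_x = 0" if "i \<ge> 2" "j \<ge> 2" for i j
  proof -
    have "(\<Sum>q = 3..t. cscale (\<beta> q) (R_bracket t \<beta> (vec_e (q + k - 2)) (vec_e l))) = 0"
      if "k \<ge> 2" "l \<ge> 2" for k l
      using that by (intro sum.neutral ballI) (simp add: idx R_bracket_unlisted)
    thus ?thesis using that by (simp add: eqs)
  qed
  have eey: "?J (vec_e i) (vec_e j) vec_y = 0" if "i \<ge> 2" "j \<ge> 2" for i j
    using that by (simp add: eqs)
  have e1x: "?J (vec_e i) (vec_e 1) vec_x = 0" if "i \<ge> 2" for i
  proof -
    have "R_bracket t \<beta> (R_bracket t \<beta> (vec_e i) (vec_e 1)) vec_x =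
        cscale (of_nat i) (vec_e (i + 1)) + (\<Sum>q = 3..t. cscale (\<beta> q) (vec_e (q + i - 2 + 1)))"
      using that by (simp add: eqs shift del: One_nat_def)
    moreover have "R_bracket t \<beta> (R_bracket t \<beta> (vec_e 1) vec_x) (vec_e i) = - vec_e (i + 1)"
      using that by (simp add: eqs del: One_nat_def)
    moreover have "R_bracket t \<beta> (R_bracket t \<beta> vec_x (vec_e i)) (vec_e 1) =
        - cscale (of_nat (i - 1)) (vec_e (i + 1))
          - (\<Sum>q = 3..t. cscale (\<beta> q) (vec_e (q + i - 2 + 1)))"
    proof -
      have "(\<Sum>q = 3..t. cscale (\<beta> q) (R_bracket t \<beta> (vec_e (q + i - 2)) (vec_e 1))) =
          (\<Sum>q = 3..t. cscale (\<beta> q) (vec_e (q + i - 2 + 1)))"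
        using that by (intro sum.cong refl) (simp add: idx R_bracket_listed del: One_nat_def)
      thus ?thesis using that by (simp add: eqs del: One_nat_def)
    qed
    moreover have "cscale (of_nat i) v = cscale (of_nat (i - 1)) v + v" for v
      using that cscale.scale_left_distrib[of "of_nat (i - 1)" 1 v] by (simp add: of_nat_diff)
    ultimately show ?thesis by simp
  qed
  have e1y: "?J (vec_e i) (vec_e 1) vec_y = 0" if "i \<ge> 2" for i
    using that by (simp add: eqs del: One_nat_def)
  have exy: "?J (vec_e i) vec_x vec_y = 0" if "i \<ge> 2" for i
  proof -
    have "(\<Sum>q = 3..t. cscale (\<beta> q) (R_bracket t \<beta> (vec_e (q + i - 2)) vec_y)) =
        (\<Sum>q = 3..t. cscale (\<beta> q) (vec_e (q + i - 2)))"
      using that by (intro sum.cong refl) (simp add: idx R_bracket_listed)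
    thus ?thesis using that by (simp add: eqs)
  qed
  have oxy: "?J (vec_e 1) vec_x vec_y = 0"
    by (simp add: eqs del: One_nat_def)
  note base = eee ee1 eex eey e1x e1y exy oxy
  note base' = base base[THEN perm(1)] base[THEN perm(2)] base[THEN perm(3)]
    base[THEN perm(4)] base[THEN perm(5)] dup dups
  define basis where "basis = {vec_x, vec_y, vec_e 1} \<union> vec_e ` {2..}"
  have base_all: "?J a b c = 0" if "a \<in> basis" "b \<in> basis" "c \<in> basis" for a b c
    using that unfolding basis_def
    by (elim UnE insertE emptyE imageE; simp only: atLeast_iff base')
  have ind: "?J a b c = 0" if "\<And>u. u \<in> basis \<Longrightarrow> ?J u b c = 0" for a b c
    by (rule R_induct[where P = "\<lambda>a. ?J a b c = 0"])
      (use that in \<open>simp_all only: add scl zro, simp_all add: basis_def\<close>)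
  have 1: "?J a b c = 0" if "b \<in> basis" "c \<in> basis" for a b c
    by (rule ind) (rule base_all[OF _ that])
  have 2: "?J a b c = 0" if "c \<in> basis" for a b c
    by (rule rotate, rule ind, rule rotate, rule rotate, rule 1) (use that in simp_all)
  show ?thesis
    by (rule rotate, rule rotate, rule ind, rule rotate, rule 2)
qed

interpretation R: lie_algebra cscale "R_bracket t \<beta>" for t \<beta>
  by unfold_locales
    (rule R_bracket_add_left R_bracket_add_right R_bracket_scale_left R_bracket_scale_right
      R_bracket_self R_jacobi)+

end

theory Submission
  imports Defs
begin

text \<open>
  Let $M$ be the span of the $e_i$ with $i \ge 2$ and $H$ the span of $x$, $y$ and $e_1$. Bracketing
  with $y$ from the right is the projection onto $M$ along $H$, and this makes $y$ the key to the
  algebra: $M$ and $H$ can be told apart by a bracket, so that every derivation that kills $y$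
  preserves both of them. Moreover $H$ acts faithfully on $M$
  (\<open>span_x_y_e1_faithful\<close>): $\alpha x + \gamma y$ has the diagonal entries $(i-1)\alpha + \gamma$, and
  $e_1$ shifts the basis. A central element commutes with $y$, hence lies in $H$, hence is zero.

  Given a derivation $d$, subtract inner derivations until nothing is left. Subtracting the one
  given by the $M$-part of $d(y)$ leaves $d(y) \in H$; then $d([m,y]) = d(m)$ forces $d(y)$ to
  annihilate $M$, so $d(y) = 0$ (\<open>derivation_y_eq_0\<close>). Now $d$ preserves $H$ and $M$, and
  $[e_1,x] = e_1$ confines $d(e_1)$ to the line of $e_1$ and $d(x)$ to the span of $y$ and $e_1$
  (\<open>derivation_x_e1\<close>). Multiples of the inner derivations of $x$ and $e_1$ remove all of this except
  a multiple $d(x) = b y$.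

  Such a $d$ commutes with the shift $S = [\cdot, e_1]$ of $M$, hence also with the polynomial
  $p(S) = \sum_q \beta_q S^{q-2}$. On $M$ one has $[\cdot, x] = N + p(S)$ with $N$ diagonal, so the
  equation obtained from $[e_2,x]$ loses all terms with $\beta$ and reads
  $N d(e_2) = d(e_2) - b e_2$. The eigenvalues of $N$ are distinct; therefore $b = 0$ and
  $d(e_2) = c e_2$. Shifting, $d$ is $c$ on $M$ and $0$ on $H$, which is the bracket with $c y$ from the
  right (\<open>inner_if_normalized\<close>).
\<close>

section \<open>Modifying a derivation by inner derivations\<close>

context lie_algebra
begin

lemma bracket_anti: "bracket a b = - bracket b a"
proof -
  have "bracket (a + b) (a + b) = 0" by (rule bracket_self)
  thus ?thesis
    by (simp add: bracket_add_left bracket_add_right bracket_self[of a] bracket_self[of b]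
      eq_neg_iff_add_eq_0 add.commute)
qed

lemma derivation_diff_ad:
  assumes "derivation d"
  shows "derivation (\<lambda>b. d b - bracket z b)"
proof -
  have leibniz: "bracket z (bracket a b) = bracket (bracket z a) b + bracket a (bracket z b)" for a b
  proof -
    have "bracket (bracket a b) z = - bracket z (bracket a b)"
      "bracket (bracket b z) a = bracket a (bracket z b)"
      by (metis bracket_anti, metis bracket_anti[of "bracket b z" a] bracket_anti[of b z]
        bracket_scale_right[of a "-1"] scale_minus_left scale_one minus_minus)
    thus ?thesis using jacobi[of a b z] by (simp add: algebra_simps)
  qed
  have diff: "bracket (a - b) c = bracket a c - bracket b c"
    "bracket c (a - b) = bracket c a - bracket c b" for a b c
    using bracket_add_left[of "a - b" b c] bracket_add_right[of c "a - b" b]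
    by (simp_all add: algebra_simps)
  show ?thesis
    using assms unfolding derivation_def Vector_Spaces.linear_iff
    by (auto simp: leibniz diff bracket_add_right bracket_scale_right scale_right_diff_distrib)
qed

lemma inner_if_inner_diff_ad:
  assumes "inner (\<lambda>b. d b - bracket z b)"
  shows "inner d"
proof -
  obtain a where "\<And>b. d b - bracket z b = bracket a b"
    using assms unfolding inner_def by blast
  hence "d b = bracket (a + z) b" for b
    by (simp add: bracket_add_left diff_eq_eq)
  thus ?thesis unfolding inner_def by blast
qed

end

section \<open>The action of y, and the center\<close>

abbreviation coord :: "R_space \<Rightarrow> gen \<Rightarrow> complex"
  where "coord \<equiv> Poly_Mapping.lookup"

lemma coord_vec:
  "coord vec_x g = (if g = X then 1 else 0)"
  "coord vec_y g = (if g = Y then 1 else 0)"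
  "coord (vec_e i) g = (if g = E (i - 1) then 1 else 0)"
  by (auto simp: vec_x_def vec_y_def vec_e_def lookup_single when_def)

lemmas R_bracket_linear = R_bracket_add_left R_bracket_add_right R_bracket_scale_left
  R_bracket_scale_right R_bracket_zero R_bracket_minus R_bracket_diff_left R_bracket_sum_left
  R_bracket_self

lemma coord_bracket_y:
  "coord (R_bracket t \<beta> a vec_y) g = (if g \<in> {X, Y, E 0} then 0 else coord a g)"
  by (induction a rule: R_induct)
    (auto simp: R_bracket_linear R_bracket_listed R_bracket_unlisted lookup_add lookup_cscale
      coord_vec simp del: One_nat_def)

text \<open>Bracketing with $y$ is a projection: the identity splits into the $H$-part, written out in
  coordinates, and the $M$-part $[a,y]$. In particular $[a,y] = 0$ says $a \in H$, and $[a,y] = a$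
  says $a \in M$; membership in both subspaces is expressed in this way below.\<close>

lemma split_bracket_y:
  "a = cscale (coord a X) vec_x + cscale (coord a Y) vec_y + cscale (coord a (E 0)) (vec_e 1)
     + R_bracket t \<beta> a vec_y"
  by (rule poly_mapping_eqI) (auto simp: lookup_add lookup_cscale coord_vec coord_bracket_y)

lemma bracket_y_fixed_iff:
  "R_bracket t \<beta> a vec_y = a \<longleftrightarrow> coord a X = 0 \<and> coord a Y = 0 \<and> coord a (E 0) = 0"
  by (auto simp: poly_mapping_eq_iff fun_eq_iff coord_bracket_y)

lemma bracket_y_idem:
  "R_bracket t \<beta> (R_bracket t \<beta> a vec_y) vec_y = R_bracket t \<beta> a vec_y"
  by (simp add: bracket_y_fixed_iff coord_bracket_y)

text \<open>The terms with \<open>\<beta>\<close> raise the index, so the diagonal entries of an element $h$ of $H$ on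
  $e_2$ and $e_3$ involve only its coordinates at $x$ and $y$, and two such entries determine these.
  What remains of $h$ is a multiple of $e_1$, which is seen on $e_2$.\<close>

lemma span_x_y_e1_faithful:
  assumes "\<And>i. i \<ge> 2 \<Longrightarrow> R_bracket t \<beta> (vec_e i) h = 0" and y: "R_bracket t \<beta> h vec_y = 0"
  shows "h = 0"
proof -
  let ?a = "coord h X" and ?b = "coord h Y" and ?c = "coord h (E 0)"
  have h: "h = cscale ?a vec_x + cscale ?b vec_y + cscale ?c (vec_e 1)"
    using split_bracket_y[of h t \<beta>] y by simp
  have coeff: "R_bracket t \<beta> (vec_e i) h =
      cscale ?a (cscale (of_nat (i - 1)) (vec_e i) + (\<Sum>q = 3..t. cscale (\<beta> q) (vec_e (q + i - 2))))
        + cscale ?b (vec_e i) + cscale ?c (vec_e (i + 1))" if "i \<ge> 2" for i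
    by (subst h) (use that in \<open>simp add: R_bracket_linear R_bracket_listed del: One_nat_def\<close>)
  have diag: "?a * of_nat (i - 1) + ?b = 0" if "i \<ge> 2" for i
  proof -
    have "(\<Sum>q = 3..t. coord (cscale (\<beta> q) (vec_e (q + i - 2))) (E (i - 1))) = 0"
      using that by (intro sum.neutral) (auto simp: lookup_cscale coord_vec)
    moreover have "coord (R_bracket t \<beta> (vec_e i) h) (E (i - 1)) = 0"
      using assms(1) that by simp
    ultimately show ?thesis
      unfolding coeff[OF that] lookup_add lookup_cscale lookup_sum
      using that by (cases i) (auto simp: lookup_cscale coord_vec)
  qed
  have ab: "?a = 0" "?b = 0"
    using diag[of 2] diag[of 3] by (auto simp: add_eq_0_iff)
  moreover have "?c = 0"
    using coeff[of 2] assms(1)[of 2] ab arg_cong[of "cscale ?c (vec_e 3)" 0 "\<lambda>v. coord v (E 2)"]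
    by (simp add: lookup_cscale coord_vec)
  ultimately show ?thesis using h by simp
qed

lemma center_zero: "R.center t \<beta> = {0}"
proof -
  have "a = 0" if a: "\<And>b. R_bracket t \<beta> a b = 0" for a
    by (rule span_x_y_e1_faithful[of t \<beta>]) (use a in \<open>simp_all add: R_bracket_anti[of _ _ _ a]\<close>)
  thus ?thesis unfolding R.center_def by (auto simp: R_bracket_zero)
qed

section \<open>The action of x as diagonal part plus polynomial in the shift\<close>

definition shift :: "nat \<Rightarrow> (nat \<Rightarrow> complex) \<Rightarrow> R_space \<Rightarrow> R_space"
  where "shift t \<beta> m = R_bracket t \<beta> m (vec_e 1)"

text \<open>The polynomial $p(S) = \sum_q \beta_q S^{q-2}$ in the shift $S$. Writing the \<open>\<beta>\<close>-part of the
  action of $x$ in this form makes it commute with everything that commutes with $S$.\<close>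

definition shift_poly :: "nat \<Rightarrow> (nat \<Rightarrow> complex) \<Rightarrow> R_space \<Rightarrow> R_space"
  where "shift_poly t \<beta> m = (\<Sum>q = 3..t. cscale (\<beta> q) ((shift t \<beta> ^^ (q - 2)) m))"

lemma shift_pow_linear:
  "(shift t \<beta> ^^ k) (a + b) = (shift t \<beta> ^^ k) a + (shift t \<beta> ^^ k) b"
  "(shift t \<beta> ^^ k) (cscale c a) = cscale c ((shift t \<beta> ^^ k) a)"
  "(shift t \<beta> ^^ k) 0 = 0"
  by (induction k) (simp_all add: shift_def R_bracket_linear)

lemma shift_poly_linear:
  "shift_poly t \<beta> (a + b) = shift_poly t \<beta> a + shift_poly t \<beta> b"
  "shift_poly t \<beta> (cscale c a) = cscale c (shift_poly t \<beta> a)"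
  "shift_poly t \<beta> 0 = 0"
  by (simp_all add: shift_poly_def shift_pow_linear cscale.scale_right_distrib sum.distrib
      cscale.scale_sum_right mult.commute)

lemma shift_pow_vec_e: "i \<ge> 2 \<Longrightarrow> (shift t \<beta> ^^ k) (vec_e i) = vec_e (i + k)"
  by (induction k) (simp_all add: shift_def R_bracket_listed(1) del: One_nat_def, simp)

lemma bracket_vec_e_x:
  assumes "i \<ge> 2"
  shows "R_bracket t \<beta> (vec_e i) vec_x = cscale (of_nat (i - 1)) (vec_e i) + shift_poly t \<beta> (vec_e i)"
  unfolding R_bracket_listed(3)[OF assms] shift_poly_def
  using assms by (intro arg_cong2[of _ _ _ _ "(+)"] refl sum.cong)
    (auto simp: shift_pow_vec_e add.commute)

text \<open>On $M$, what $x$ does beyond $p(S)$ is diagonal. Its eigenvalue at \<open>E j\<close> is $j$ because this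
  label stands for $e_{j+1}$.\<close>

lemma coord_bracket_x:
  assumes "R_bracket t \<beta> m vec_y = m"
  shows "coord (R_bracket t \<beta> m vec_x - shift_poly t \<beta> m) (E j) = of_nat j * coord m (E j)"
proof -
  \<comment> \<open>Elements of $M$ are written as $[a,y]$ with arbitrary $a$, so that \<open>R_induct\<close> applies.\<close>
  have "coord (R_bracket t \<beta> (R_bracket t \<beta> a vec_y) vec_x - shift_poly t \<beta> (R_bracket t \<beta> a vec_y)) (E j)
      = of_nat j * coord (R_bracket t \<beta> a vec_y) (E j)" for a
  proof (induction a rule: R_induct)
    case (2 a b)
    show ?case
      using arg_cong2[OF 2, of "(+)"]
      by (simp only: R_bracket_add_left shift_poly_linear lookup_add lookup_minus distrib_left add_diff_add)
  next
    case (3 c a)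
    show ?case
      using arg_cong[OF 3, of "(*) c"]
      by (simp only: R_bracket_scale_left shift_poly_linear lookup_cscale lookup_minus
          right_diff_distrib mult.left_commute)
  next
    case (7 i)
    thus ?case
      by (auto simp: R_bracket_listed(4) bracket_vec_e_x lookup_cscale coord_vec)
  qed (simp_all add: R_bracket_self R_bracket_zero R_bracket_unlisted shift_poly_linear
      del: One_nat_def)
  from this[of m] show ?thesis by (simp only: assms)
qed

section \<open>Derivations\<close>

context
  fixes t :: nat and \<beta> :: "nat \<Rightarrow> complex" and d :: "R_space \<Rightarrow> R_space"
  assumes d: "R.derivation t \<beta> d"
begin

lemma derivation_linear:
  "d (a + b) = d a + d b" "d (cscale c a) = cscale c (d a)" "d 0 = 0"
  "d (sum f A) = (\<Sum>i\<in>A. d (f i))"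
proof -
  interpret d: Vector_Spaces.linear cscale cscale d
    using d unfolding R.derivation_def by simp
  show "d (a + b) = d a + d b" "d (cscale c a) = cscale c (d a)" "d 0 = 0"
    "d (sum f A) = (\<Sum>i\<in>A. d (f i))"
    by (fact d.add d.scale d.zero d.sum)+
qed

lemma derivation_bracket: "d (R_bracket t \<beta> a b) = R_bracket t \<beta> (d a) b + R_bracket t \<beta> a (d b)"
  using d unfolding R.derivation_def by blast

text \<open>For $m \in M$ the derivation rule for $m = [m,y]$ reads $d(m) = [d(m),y] + [m,d(y)]$. Both
  brackets lie in $M$, so projecting to $M$ turns the first one into itself and $d(m)$ into it as
  well; hence $[m,d(y)] = 0$, and faithfulness applies.\<close>

lemma derivation_y_eq_0:
  assumes y: "R_bracket t \<beta> (d vec_y) vec_y = 0"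
  shows "d vec_y = 0"
proof (rule span_x_y_e1_faithful[OF _ y])
  fix i :: nat assume i: "i \<ge> 2"
  let ?m = "vec_e i"
  have eq: "d ?m = R_bracket t \<beta> (d ?m) vec_y + R_bracket t \<beta> ?m (d vec_y)"
    using derivation_bracket[of ?m vec_y] i by (simp add: R_bracket_listed)
  have fix_br: "R_bracket t \<beta> (R_bracket t \<beta> ?m (d vec_y)) vec_y = R_bracket t \<beta> ?m (d vec_y)"
    using R_jacobi[of t \<beta> ?m "d vec_y" vec_y] y i
    by (simp add: R_bracket_zero R_bracket_anti[of t \<beta> vec_y] R_bracket_listed R_bracket_minus)
  show "R_bracket t \<beta> ?m (d vec_y) = 0"
    using arg_cong[OF eq, of "\<lambda>v. R_bracket t \<beta> v vec_y"]
    by (simp add: R_bracket_add_left bracket_y_idem fix_br)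
qed

lemma derivation_commutes_bracket_y:
  assumes "d vec_y = 0"
  shows "R_bracket t \<beta> (d a) vec_y = d (R_bracket t \<beta> a vec_y)"
  using derivation_bracket[of a vec_y] assms by (simp add: R_bracket_zero)

text \<open>Since $d$ preserves $H$, the images of $x$ and $e_1$ have only three coordinates each. Inside
  $H$ the bracket with $x$ sees nothing but $e_1$, so the derivation rule for $[e_1,x] = e_1$ puts
  $d(e_1)$ on the line of $e_1$, and comparing the coefficients there leaves no $x$ in $d(x)$.\<close>

lemma derivation_x_e1:
  assumes y: "d vec_y = 0"
  obtains b c g where "d vec_x = cscale b vec_y + cscale g (vec_e 1)"
    "d (vec_e 1) = cscale c (vec_e 1)"
proof -
  have "R_bracket t \<beta> (d vec_x) vec_y = 0" "R_bracket t \<beta> (d (vec_e 1)) vec_y = 0"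
    by (simp_all add: derivation_commutes_bracket_y[OF y] R_bracket_unlisted derivation_linear del: One_nat_def)
  then obtain a b g a' b' c where
    x: "d vec_x = cscale a vec_x + cscale b vec_y + cscale g (vec_e 1)" and
    e: "d (vec_e 1) = cscale a' vec_x + cscale b' vec_y + cscale c (vec_e 1)"
    using split_bracket_y[of "d vec_x" t \<beta>] split_bracket_y[of "d (vec_e 1)" t \<beta>] by (metis add.right_neutral)
  have yx: "R_bracket t \<beta> vec_y vec_x = 0"
    by (subst R_bracket_anti) (simp add: R_bracket_unlisted)
  have eq: "cscale a' vec_x + cscale b' vec_y + cscale c (vec_e 1) = cscale (c + a) (vec_e 1)"
    using derivation_bracket[of "vec_e 1" vec_x]
    by (simp add: x e R_bracket_linear R_bracket_listed R_bracket_unlisted yx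
        cscale.scale_left_distrib del: One_nat_def)
  have "a' = 0" "b' = 0" "a = 0"
    using arg_cong[OF eq, of "\<lambda>v. coord v X"] arg_cong[OF eq, of "\<lambda>v. coord v Y"]
      arg_cong[OF eq, of "\<lambda>v. coord v (E 0)"]
    by (simp_all add: lookup_add lookup_cscale coord_vec)
  thus ?thesis using that[of b g c] x e by simp
qed

text \<open>The element $e_2$ generates $M$ under the shift, so $d$ is determined by $d(e_2)$. The relation
  for $[e_2,x]$ says that $d(e_2)$ lies in the eigenspace of $e_2$ for the diagonal part of $x$, up
  to the term $b e_2$; that term has to vanish because $e_2$ itself has eigenvalue $1$.\<close>

lemma inner_if_normalized:
  assumes y: "d vec_y = 0" and e1: "d (vec_e 1) = 0" and x: "d vec_x = cscale b vec_y"
  shows "R.inner t \<beta> d"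
proof -
  let ?v = "d (vec_e 2)"
  have v: "R_bracket t \<beta> ?v vec_y = ?v"
    by (simp add: derivation_commutes_bracket_y[OF y] R_bracket_listed)
  have shift: "d (shift t \<beta> a) = shift t \<beta> (d a)" for a
    by (simp add: shift_def derivation_bracket e1 R_bracket_zero del: One_nat_def)
  hence "d ((shift t \<beta> ^^ k) a) = (shift t \<beta> ^^ k) (d a)" for k a
    by (induction k) simp_all
  hence "d (shift_poly t \<beta> a) = shift_poly t \<beta> (d a)" for a
    by (simp add: shift_poly_def derivation_linear)
  \<comment> \<open>Both sides of the relation for $[e_2,x]$ contain $p(S)$ applied to $d(e_2)$, which cancels.\<close>
  hence "R_bracket t \<beta> ?v vec_x - shift_poly t \<beta> ?v = ?v - cscale b (vec_e 2)"
    using derivation_bracket[of "vec_e 2" vec_x]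
    by (simp add: bracket_vec_e_x derivation_linear x R_bracket_linear R_bracket_listed algebra_simps)
  hence coeff: "of_nat j * coord ?v (E j) = coord ?v (E j) - b * (if j = 1 then 1 else 0)" for j
    using coord_bracket_x[OF v, of j] by (simp add: lookup_minus lookup_cscale coord_vec)
  have b: "b = 0" using coeff[of 1] by simp
  define c where "c = coord ?v (E 1)"
  have "coord ?v (E j) = 0" if "j \<noteq> 1" for j
    using coeff[of j] that b by simp
  hence e2: "?v = cscale c (vec_e 2)"
    using v unfolding bracket_y_fixed_iff
    by (intro poly_mapping_eqI, rename_tac g, case_tac g)
      (auto simp: lookup_cscale coord_vec c_def)
  have e: "d (vec_e i) = cscale c (vec_e i)" if "i \<ge> 2" for i
    using that
  proof (induction i rule: dec_induct)
    case (step i)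
    have "d (shift t \<beta> (vec_e i)) = cscale c (shift t \<beta> (vec_e i))"
      unfolding shift step.IH by (simp add: shift_def R_bracket_scale_left)
    thus ?case using step.hyps unfolding Suc_eq_plus1
      by (simp add: shift_def R_bracket_listed(1) del: One_nat_def)
  qed (rule e2)
  have "d a = R_bracket t \<beta> a (cscale c vec_y)" for a
    by (induction a rule: R_induct)
      (simp_all add: R_bracket_linear derivation_linear R_bracket_listed R_bracket_unlisted x y e e1 b
        cscale.scale_right_distrib del: One_nat_def)
  hence "d a = R_bracket t \<beta> (cscale (- c) vec_y) a" for a
    by (subst R_bracket_anti) (simp add: R_bracket_linear)
  thus ?thesis unfolding R.inner_def by blast
qed

end

theorem theorem3p3:
  fixes t :: nat and \<beta> :: "nat \<Rightarrow> complex"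
  shows "lie_algebra.complete cscale (R_bracket t \<beta>)"
  unfolding R.complete_def
proof (intro conjI allI impI center_zero)
  fix d assume d: "R.derivation t \<beta> d"
  \<comment> \<open>The element $[d(y),y]$ is the $M$-part of $d(y)$, and $[m,y] = m$ on $M$: this leaves
    $d_1(y)$ in $H$.\<close>
  define d1 where "d1 = (\<lambda>b. d b - R_bracket t \<beta> (R_bracket t \<beta> (d vec_y) vec_y) b)"
  have d1: "R.derivation t \<beta> d1"
    unfolding d1_def by (rule R.derivation_diff_ad[OF d])
  have y1: "d1 vec_y = 0"
    by (rule derivation_y_eq_0[OF d1]) (simp add: d1_def R_bracket_diff_left bracket_y_idem)
  obtain b c g where x1: "d1 vec_x = cscale b vec_y + cscale g (vec_e 1)"
    and e1: "d1 (vec_e 1) = cscale c (vec_e 1)"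
    using derivation_x_e1[OF d1 y1] by blast
  \<comment> \<open>From $[e_1,x] = e_1$: the bracket with \<open>z\<close> sends $x$ to $g e_1$, $e_1$ to $c e_1$ and $y$ to $0$.\<close>
  define z where "z = cscale g (vec_e 1) - cscale c vec_x"
  define d2 where "d2 = (\<lambda>b. d1 b - R_bracket t \<beta> z b)"
  have d2: "R.derivation t \<beta> d2"
    unfolding d2_def by (rule R.derivation_diff_ad[OF d1])
  have "R_bracket t \<beta> vec_x (vec_e 1) = - vec_e 1"
    by (subst R_bracket_anti) (simp add: R_bracket_listed del: One_nat_def)
  hence "d2 vec_y = 0" "d2 (vec_e 1) = 0" "d2 vec_x = cscale b vec_y"
    by (simp_all add: d2_def z_def y1 x1 e1 R_bracket_linear R_bracket_listed R_bracket_unlisted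
        del: One_nat_def)
  hence "R.inner t \<beta> d2"
    by (rule inner_if_normalized[OF d2])
  hence "R.inner t \<beta> d1"
    unfolding d2_def by (rule R.inner_if_inner_diff_ad)
  thus "R.inner t \<beta> d"
    unfolding d1_def by (rule R.inner_if_inner_diff_ad)
qed

end
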